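(* Let $\omega,m,t_0\in\mathbb{R}$ and put $$a_2=\frac{\sqrt3}{3}(3m+\sqrt3),\qquad \alpha=\frac{4\sqrt3}{3}(2m+\sqrt3),\qquad n=-\frac{2\sqrt3}{3}(4m+\sqrt3),$$ $$\Lambda_0=\frac16(3+2\omega)(4m+\sqrt3)^2,\qquad \rho_0=-\frac{1}{16\pi}\left(32\omega\Big(m+\frac{\sqrt3}{4}\Big)^2+9+24\sqrt3\,m+44m^2\right).$$ Then, for $t>-t_0$, the functions $$a=t+t_0,\quad b=d=(t+t_0)^{a_2},\quad \rho=\rho_0(t+t_0)^{-\alpha},\quad \phi=(t+t_0)^n,\quad \Lambda=\Lambda_0(t+t_0)^{-2},$$ where $\Lambda(\phi)=\Lambda_0\phi^{-2/n}$ if $n\ne0$ and $\Lambda(\phi)\equiv0$ if $n=0$, form a solution of the Bianchi $\mathrm{VI}_0$ scalar-tensor (Brans-Dicke with $\Lambda(\phi)$) field equations with $b=d$, constant coupling $\omega$ and equation of state $p=\frac13\rho$ (listed in the context).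
   Context: A prime denotes $d/dt$. The unknowns are the scale factors $a(t)$ and $b(t)=d(t)$ of the Bianchi $\mathrm{VI}_0$ metric with structure parameter $m$, $ds^2=-dt^2+a^2dx^2+b^2(\cosh 2mx\,dy^2-2\sinh 2mx\,dy\,dz+\cosh 2mx\,dz^2)$, the energy density $\rho(t)$ of a perfect fluid with pressure $p=\frac13\rho$, the scalar field $\phi(t)>0$ and the function $\Lambda(\phi)$. With $H=\frac{a'}{a}+2\frac{b'}{b}$, the field equations are: $$2\frac{a'}{a}\frac{b'}{b}+\Big(\frac{b'}{b}\Big)^2-\frac{m^2}{a^2}=\frac{8\pi}{\phi}\rho-H\frac{\phi'}{\phi}+\frac{\omega}{2}\Big(\frac{\phi'}{\phi}\Big)^2+\Lambda(\phi),$$ $$2\frac{b''}{b}+\Big(\frac{b'}{b}\Big)^2+\frac{m^2}{a^2}=-\frac{8\pi}{\phi}p-2\frac{\phi'}{\phi}\frac{b'}{b}-\frac{\omega}{2}\Big(\frac{\phi'}{\phi}\Big)^2-\frac{\phi''}{\phi}+\Lambda(\phi),$$ $$\frac{a''}{a}+\frac{b''}{b}+\frac{a'}{a}\frac{b'}{b}-\frac{m^2}{a^2}=-\frac{8\pi}{\phi}p-\frac{\phi'}{\phi}\Big(\frac{a'}{a}+\frac{b'}{b}\Big)-\frac{\omega}{2}\Big(\frac{\phi'}{\phi}\Big)^2-\frac{\phi''}{\phi}+\Lambda(\phi),$$ $$(3+2\omega)\Big(\frac{\phi''}{\phi}+H\frac{\phi'}{\phi}\Big)-2\Big(\Lambda-\phi\frac{d\Lambda}{d\phi}\Big)=\frac{8\pi}{\phi}(\rho-3p),\qquad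 \rho'+(\rho+p)H=0 .$$ *)

theory Defs
  imports "HOL-Analysis.Analysis"
begin

definition twice_differentiable_on_open :: "(real \<Rightarrow> real) \<Rightarrow> real set \<Rightarrow> bool" where
  "twice_differentiable_on_open f I \<longleftrightarrow>
     open I \<and> (\<forall>t\<in>I. f field_differentiable (at t)) \<and> (\<forall>t\<in>I. deriv f field_differentiable (at t))"

definition hubble :: "(real \<Rightarrow> real) \<Rightarrow> (real \<Rightarrow> real) \<Rightarrow> real \<Rightarrow> real" where
  "hubble a b t = deriv a t / a t + 2 * (deriv b t / b t)"

(* Field equations of scalar-tensor gravity (constant coupling \<omega>, cosmological function \<Lambda>)
   for a perfect fluid with density \<rho> and pressure p in the Bianchi VI_0 metric
     ds^2 = - dt^2 + a^2 dx^2 + b^2 (cosh(2mx) dy^2 - 2 sinh(2mx) dy dz + cosh(2mx) dz^2),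
   i.e. with the last two scale factors b and d equal.  Here \<Lambda> is a function of the value of
   the scalar field, not of time: along the solution it is evaluated at \<phi> t, and its derivative
   in the wave equation for \<phi> is the one with respect to the field value.  The regularity and
   positivity conditions make every derivative and quotient in the equations meaningful. *)
definition bianchi_VI0_scalar_tensor_solution ::
  "real \<Rightarrow> real \<Rightarrow> real set \<Rightarrow> (real \<Rightarrow> real) \<Rightarrow> (real \<Rightarrow> real) \<Rightarrow> (real \<Rightarrow> real) \<Rightarrow> (real \<Rightarrow> real) \<Rightarrow>
   (real \<Rightarrow> real) \<Rightarrow> (real \<Rightarrow> real) \<Rightarrow> bool" where
  "bianchi_VI0_scalar_tensor_solution \<omega> m I a b \<rho> p \<phi> \<Lambda> \<longleftrightarrow>
     twice_differentiable_on_open a I \<and>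
     twice_differentiable_on_open b I \<and>
     twice_differentiable_on_open \<phi> I \<and>
     (\<forall>t\<in>I.
        a t > 0 \<and> b t > 0 \<and> \<phi> t > 0 \<and>
        \<rho> field_differentiable (at t) \<and>
        \<Lambda> field_differentiable (at (\<phi> t)) \<and>
        2 * (deriv a t / a t) * (deriv b t / b t) + (deriv b t / b t)^2 - m^2 / (a t)^2
          = 8 * pi / \<phi> t * \<rho> t - hubble a b t * (deriv \<phi> t / \<phi> t)
            + \<omega> / 2 * (deriv \<phi> t / \<phi> t)^2 + \<Lambda> (\<phi> t) \<and>
        2 * (deriv (deriv b) t / b t) + (deriv b t / b t)^2 + m^2 / (a t)^2
          = - (8 * pi / \<phi> t * p t) - 2 * (deriv \<phi> t / \<phi> t) * (deriv b t / b t)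
            - \<omega> / 2 * (deriv \<phi> t / \<phi> t)^2 - deriv (deriv \<phi>) t / \<phi> t + \<Lambda> (\<phi> t) \<and>
        deriv (deriv a) t / a t + deriv (deriv b) t / b t
            + (deriv a t / a t) * (deriv b t / b t) - m^2 / (a t)^2
          = - (8 * pi / \<phi> t * p t) - (deriv \<phi> t / \<phi> t) * (deriv a t / a t + deriv b t / b t)
            - \<omega> / 2 * (deriv \<phi> t / \<phi> t)^2 - deriv (deriv \<phi>) t / \<phi> t + \<Lambda> (\<phi> t) \<and>
        (3 + 2 * \<omega>) * (deriv (deriv \<phi>) t / \<phi> t + hubble a b t * (deriv \<phi> t / \<phi> t))
            - 2 * (\<Lambda> (\<phi> t) - \<phi> t * deriv \<Lambda> (\<phi> t))
          = 8 * pi / \<phi> t * (\<rho> t - 3 * p t) \<and>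
        deriv \<rho> t + (\<rho> t + p t) * hubble a b t = 0)"

end

(* Every term of the field equations is a constant times (t + t\<^sub>0)^(-2), or times
   (t + t\<^sub>0)^(-\<alpha>-1) in the conservation law, so the system reduces to polynomial identities
   in m, \<omega> and sqrt 3.  They rest on \<alpha> = 2 - n, which makes \<rho> / \<phi> homogeneous of degree -2,
   and on \<Lambda>\<^sub>0 = (3 + 2 \<omega>) n^2 / 8, which also makes \<Lambda>\<^sub>0 vanish in the case n = 0. *)
theory Submission
  imports Defs
begin

lemma has_field_derivative_shifted_powr:
  fixes c r t :: real
  assumes "- c < t"
  shows "((\<lambda>t. (t + c) powr r) has_field_derivative r * (t + c) powr (r - 1)) (at t)"
  using assms by (auto intro!: derivative_eq_intros)

lemma deriv_shifted_powr:
  fixes c r t :: real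
  assumes "- c < t"
  shows "deriv (\<lambda>t. (t + c) powr r) t = r * (t + c) powr (r - 1)"
  using has_field_derivative_shifted_powr[OF assms] by (rule DERIV_imp_deriv)

text \<open>The closed form of the first derivative is available only for arguments above
  \<open>- c\<close>. Since this half-line is open, the two functions agree near \<open>t\<close>,
  which is enough to differentiate once more.\<close>

lemma has_field_derivative_deriv_shifted_powr:
  fixes c r t :: real
  assumes "- c < t"
  shows "(deriv (\<lambda>t. (t + c) powr r) has_field_derivative
           r * (r - 1) * (t + c) powr (r - 2)) (at t)"
proof (rule has_field_derivative_transform_within_open)
  show "((\<lambda>t. r * (t + c) powr (r - 1)) has_field_derivative
          r * (r - 1) * (t + c) powr (r - 2)) (at t)"
    using DERIV_cmult[OF has_field_derivative_shifted_powr[OF assms, of "r - 1"], of r]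
    by (simp add: mult.assoc)
  show "r * (s + c) powr (r - 1) = deriv (\<lambda>t. (t + c) powr r) s" if "s \<in> {- c <..}" for s
    using that by (simp add: deriv_shifted_powr)
qed (use assms in auto)

lemma twice_differentiable_shifted_powr:
  fixes c r :: real
  shows "twice_differentiable_on_open (\<lambda>t. (t + c) powr r) {- c <..}"
  unfolding twice_differentiable_on_open_def field_differentiable_def
  using has_field_derivative_shifted_powr has_field_derivative_deriv_shifted_powr
  by fastforce

text \<open>Logarithmic derivatives are all that the field equations see of a power. The factor
  \<open>1 / (t + c)\<close> is kept intact so that it can later be folded into a single
  variable.\<close>

lemma deriv_shifted_powr_quotient:
  fixes c r t :: real
  assumes "- c < t"
  shows "deriv (\<lambda>t. (t + c) powr r) t / (t + c) powr r = r * (1 / (t + c))"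
  using assms by (simp add: deriv_shifted_powr powr_diff)

lemma deriv_deriv_shifted_powr_quotient:
  fixes c r t :: real
  assumes "- c < t"
  shows "deriv (deriv (\<lambda>t. (t + c) powr r)) t / (t + c) powr r = r * (r - 1) * (1 / (t + c))\<^sup>2"
  using assms DERIV_imp_deriv[OF has_field_derivative_deriv_shifted_powr[OF assms, of r]]
  by (simp add: powr_diff power2_eq_square)

theorem mainTheorem5:
  fixes \<omega> m t\<^sub>0 a\<^sub>2 \<alpha> n \<Lambda>\<^sub>0 \<rho>\<^sub>0 :: real
    and a b \<rho> p \<phi> \<Lambda> :: "real \<Rightarrow> real"
  defines "a\<^sub>2 \<equiv> sqrt 3 / 3 * (3 * m + sqrt 3)"
    and "\<alpha> \<equiv> 4 * sqrt 3 / 3 * (2 * m + sqrt 3)"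
    and "n \<equiv> - (2 * sqrt 3 / 3 * (4 * m + sqrt 3))"
    and "\<Lambda>\<^sub>0 \<equiv> 1 / 6 * (3 + 2 * \<omega>) * (4 * m + sqrt 3)^2"
    and "\<rho>\<^sub>0 \<equiv> - (1 / (16 * pi) * (32 * \<omega> * (m + sqrt 3 / 4)^2 + 9 + 24 * sqrt 3 * m + 44 * m^2))"
    and "a \<equiv> \<lambda>t. t + t\<^sub>0"
    and "b \<equiv> \<lambda>t. (t + t\<^sub>0) powr a\<^sub>2"
    and "\<rho> \<equiv> \<lambda>t. \<rho>\<^sub>0 * (t + t\<^sub>0) powr (- \<alpha>)"
    and "p \<equiv> \<lambda>t. 1 / 3 * \<rho> t"
    and "\<phi> \<equiv> \<lambda>t. (t + t\<^sub>0) powr n"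
    and "\<Lambda> \<equiv> \<lambda>x. if n \<noteq> 0 then \<Lambda>\<^sub>0 * x powr (- 2 / n) else 0"
  shows "bianchi_VI0_scalar_tensor_solution \<omega> m {- t\<^sub>0 <..} a b \<rho> p \<phi> \<Lambda> \<and>
         (\<forall>t > - t\<^sub>0. \<Lambda> (\<phi> t) = \<Lambda>\<^sub>0 * (t + t\<^sub>0) powr (- 2))"
proof -
  \<comment> \<open>The second rule catches the right-nested products that
    \<open>algebra_simps\<close> produces.\<close>
  have s3: "sqrt 3 * sqrt 3 = (3::real)" "sqrt 3 * (sqrt 3 * x) = 3 * x" for x :: real
    by (simp_all flip: mult.assoc)
  have a2: "a\<^sub>2 = sqrt 3 * m + 1"
    unfolding a\<^sub>2_def by (simp add: algebra_simps s3)
  have n: "n = - (8 / 3 * (sqrt 3 * m) + 2)"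
    unfolding n_def by (simp add: algebra_simps s3)
  have alpha: "\<alpha> = 2 - n"
    unfolding n \<alpha>_def by (simp add: algebra_simps s3)
  have Lambda0: "\<Lambda>\<^sub>0 = (3 + 2 * \<omega>) * n\<^sup>2 / 8"
    unfolding n_def \<Lambda>\<^sub>0_def by (simp add: field_simps power2_eq_square s3)
  \<comment> \<open>\<open>\<rho>\<^sub>0\<close> enters the first three field equations only
    through this product, so \<open>pi\<close> disappears from them.\<close>
  have rho0: "8 * pi * \<rho>\<^sub>0 = - (3 / 4 * \<omega> * n\<^sup>2 + 9 / 2 + 12 * (sqrt 3 * m) + 22 * m\<^sup>2)"
    unfolding n \<rho>\<^sub>0_def by (simp add: field_simps power2_eq_square s3)
  \<comment> \<open>In terms of \<open>k\<close> the square root is gone: the parameters become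
    polynomials in \<open>k\<close> and \<omega> with rational coefficients.\<close>
  define k where "k = sqrt 3 * m"
  have k2: "m\<^sup>2 = k\<^sup>2 / 3"
    unfolding k_def by (simp add: power_mult_distrib)
  note param = a2[folded k_def] n[folded k_def] Lambda0 k2

  have da: "deriv a t = 1" for t
    unfolding a_def by (rule DERIV_imp_deriv) (auto intro!: derivative_eq_intros)
  have dda: "deriv (deriv a) t = 0" for t
  proof -
    have "deriv a = (\<lambda>t. 1)" using da by blast
    then show ?thesis by simp
  qed
  have diff_a: "twice_differentiable_on_open a {- t\<^sub>0 <..}"
  proof -
    have "deriv a = (\<lambda>t. 1)" using da by blast
    then show ?thesis
      unfolding twice_differentiable_on_open_def
      by (auto simp: a_def intro!: derivative_intros)
  qed

  have Lambda_phi: "\<Lambda> (\<phi> t) = \<Lambda>\<^sub>0 * (1 / (t + t\<^sub>0))\<^sup>2" if "- t\<^sub>0 < t" for t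
  proof -
    have u: "t + t\<^sub>0 > 0" using that by simp
    show ?thesis
    proof (cases "n = 0")
      case True
      then show ?thesis by (simp add: \<Lambda>_def Lambda0)
    next
      case False
      then show ?thesis
        using u by (simp add: \<Lambda>_def \<phi>_def powr_powr powr_minus power_divide field_simps)
    qed
  qed
  \<comment> \<open>For \<open>n = 0\<close> the formula still holds: \<Lambda> is then constantly
    zero, and so is the stated derivative.\<close>
  have Lambda_deriv: "(\<Lambda> has_field_derivative (- 2 / n) * \<Lambda> x / x) (at x)" if "x > 0" for x
  proof (cases "n = 0")
    case True
    then show ?thesis by (simp add: \<Lambda>_def)
  next
    case False
    have "((\<lambda>x. \<Lambda>\<^sub>0 * x powr (- 2 / n)) has_field_derivative
            \<Lambda>\<^sub>0 * ((- 2 / n) * x powr (- 2 / n - 1))) (at x)"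
      by (intro DERIV_cmult has_real_derivative_powr that)
    then show ?thesis
      using False that by (simp add: \<Lambda>_def powr_diff mult_ac)
  qed

  have "a t > 0 \<and> b t > 0 \<and> \<phi> t > 0 \<and>
        \<rho> field_differentiable (at t) \<and>
        \<Lambda> field_differentiable (at (\<phi> t)) \<and>
        2 * (deriv a t / a t) * (deriv b t / b t) + (deriv b t / b t)^2 - m^2 / (a t)^2
          = 8 * pi / \<phi> t * \<rho> t - hubble a b t * (deriv \<phi> t / \<phi> t)
            + \<omega> / 2 * (deriv \<phi> t / \<phi> t)^2 + \<Lambda> (\<phi> t) \<and>
        2 * (deriv (deriv b) t / b t) + (deriv b t / b t)^2 + m^2 / (a t)^2
          = - (8 * pi / \<phi> t * p t) - 2 * (deriv \<phi> t / \<phi> t) * (deriv b t / b t)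
            - \<omega> / 2 * (deriv \<phi> t / \<phi> t)^2 - deriv (deriv \<phi>) t / \<phi> t + \<Lambda> (\<phi> t) \<and>
        deriv (deriv a) t / a t + deriv (deriv b) t / b t
            + (deriv a t / a t) * (deriv b t / b t) - m^2 / (a t)^2
          = - (8 * pi / \<phi> t * p t) - (deriv \<phi> t / \<phi> t) * (deriv a t / a t + deriv b t / b t)
            - \<omega> / 2 * (deriv \<phi> t / \<phi> t)^2 - deriv (deriv \<phi>) t / \<phi> t + \<Lambda> (\<phi> t) \<and>
        (3 + 2 * \<omega>) * (deriv (deriv \<phi>) t / \<phi> t + hubble a b t * (deriv \<phi> t / \<phi> t))
            - 2 * (\<Lambda> (\<phi> t) - \<phi> t * deriv \<Lambda> (\<phi> t))
          = 8 * pi / \<phi> t * (\<rho> t - 3 * p t) \<and>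
        deriv \<rho> t + (\<rho> t + p t) * hubble a b t = 0"
    (is "?pos_a \<and> ?pos_b \<and> ?pos_phi \<and> ?diff_rho \<and> ?diff_Lambda \<and>
         ?eq1 \<and> ?eq2 \<and> ?eq3 \<and> ?wave \<and> ?cons")
    if t: "- t\<^sub>0 < t" for t
  proof -
    define w where "w = 1 / (t + t\<^sub>0)"
    have pos: "t + t\<^sub>0 > 0" using t by simp
    have pos_phi: "\<phi> t > 0" using pos by (simp add: \<phi>_def)
    \<comment> \<open>The derivative is rewritten first, before unfolding \<open>a\<close> would
      hide it from \<open>da\<close>.\<close>
    have qa: "deriv a t / a t = w" "m\<^sup>2 / (a t)\<^sup>2 = m\<^sup>2 * w\<^sup>2"
      by (simp_all only: da) (simp_all add: a_def w_def power_divide)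
    have qb: "deriv b t / b t = a\<^sub>2 * w"
      unfolding b_def w_def using deriv_shifted_powr_quotient[OF t] .
    have qbb: "deriv (deriv b) t / b t = a\<^sub>2 * (a\<^sub>2 - 1) * w\<^sup>2"
      unfolding b_def w_def using deriv_deriv_shifted_powr_quotient[OF t] .
    have qp: "deriv \<phi> t / \<phi> t = n * w"
      unfolding \<phi>_def w_def using deriv_shifted_powr_quotient[OF t] .
    have qpp: "deriv (deriv \<phi>) t / \<phi> t = n * (n - 1) * w\<^sup>2"
      unfolding \<phi>_def w_def using deriv_deriv_shifted_powr_quotient[OF t] .
    have H: "hubble a b t = (1 + 2 * a\<^sub>2) * w"
      unfolding hubble_def qa qb by (simp add: algebra_simps)
    have rho_phi: "8 * pi / \<phi> t * \<rho> t = 8 * pi * \<rho>\<^sub>0 * w\<^sup>2"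
      unfolding \<phi>_def \<rho>_def w_def alpha
      using pos by (simp add: powr_diff power_divide)
    have p_phi: "8 * pi / \<phi> t * p t = 8 * pi * \<rho>\<^sub>0 * w\<^sup>2 / 3"
      unfolding p_def rho_phi[symmetric] by simp
    note rho0 = rho0[folded k_def]
    have L: "\<Lambda> (\<phi> t) = \<Lambda>\<^sub>0 * w\<^sup>2"
      using Lambda_phi[OF t] by (simp add: w_def)
    have dL: "\<phi> t * deriv \<Lambda> (\<phi> t) = - 2 / n * (\<Lambda>\<^sub>0 * w\<^sup>2)"
      using DERIV_imp_deriv[OF Lambda_deriv[OF pos_phi]] pos_phi L by simp
    have drho: "(\<rho> has_field_derivative (- \<alpha>) * \<rho> t * w) (at t)"
      unfolding \<rho>_def
      using DERIV_cmult[OF has_field_derivative_shifted_powr[OF t, of "- \<alpha>"], of \<rho>\<^sub>0] pos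
      by (simp add: powr_diff w_def mult_ac)

    have ?pos_a ?pos_b using pos by (simp_all add: a_def b_def)
    moreover have ?diff_rho ?diff_Lambda
      using drho Lambda_deriv[OF pos_phi] unfolding field_differentiable_def by blast+
    \<comment> \<open>The \<omega> terms cancel: the coefficients of
      \<open>\<omega> * n\<^sup>2 * w\<^sup>2\<close> are -3/4 from the density, 1/2 from the
      kinetic term and 1/4 from \<open>\<Lambda>\<^sub>0\<close>. In the next two equations they are
      1/4, -1/2 and 1/4. What remains is \<open>w\<^sup>2\<close> times an identity between
      quadratics in \<open>k\<close>.\<close>
    moreover have ?eq1
      unfolding qa qb qp H rho_phi rho0 L
      unfolding param
      by (simp add: field_simps power2_eq_square)
    moreover have ?eq2
      unfolding qa qb qbb qp qpp p_phi rho0 L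
      unfolding param
      by (simp add: field_simps power2_eq_square)
    moreover have ?eq3
      unfolding dda qa qb qbb qp qpp p_phi rho0 L
      unfolding param
      by (simp add: field_simps power2_eq_square)
    moreover have ?wave
    proof -
      \<comment> \<open>The difference is
        \<open>(1 + 2 / n) * \<Lambda>\<^sub>0 * w\<^sup>2\<close>, and the factor
        \<open>n\<^sup>2\<close> in \<open>\<Lambda>\<^sub>0\<close> absorbs the division; for
        \<open>n = 0\<close> both sides vanish.\<close>
      have "2 * (\<Lambda> (\<phi> t) - \<phi> t * deriv \<Lambda> (\<phi> t)) = (3 + 2 * \<omega>) * n * (n + 2) / 4 * w\<^sup>2"
        unfolding dL L Lambda0
        by (cases "n = 0") (simp_all add: field_simps power2_eq_square)
      \<comment> \<open>This reduces to \<open>n + 2 * a\<^sub>2 = (n + 2) / 4\<close>, both sides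
        being \<open>- 2 / 3 * k\<close>.\<close>
      moreover have "(3 + 2 * \<omega>) * (n * (n - 1) * w\<^sup>2 + (1 + 2 * a\<^sub>2) * w * (n * w))
          = (3 + 2 * \<omega>) * n * (n + 2) / 4 * w\<^sup>2"
        unfolding param by (simp add: field_simps power2_eq_square)
      moreover have "8 * pi / \<phi> t * (\<rho> t - 3 * p t) = 0"
        by (simp add: p_def)
      ultimately show ?thesis
        unfolding H qp qpp by (simp only: diff_self)
    qed
    \<comment> \<open>With \<open>p\<close> a third of the density, conservation amounts to
      \<open>\<alpha> = 4 / 3 * (1 + 2 * a\<^sub>2)\<close>; both sides are
      \<open>4 + 8 / 3 * k\<close>.\<close>
    moreover have ?cons
      unfolding DERIV_imp_deriv[OF drho] H p_def alpha param
      by (simp add: field_simps)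
    ultimately show ?thesis using pos_phi by blast
  qed
  then have "bianchi_VI0_scalar_tensor_solution \<omega> m {- t\<^sub>0 <..} a b \<rho> p \<phi> \<Lambda>"
    unfolding bianchi_VI0_scalar_tensor_solution_def
    using diff_a twice_differentiable_shifted_powr[of t\<^sub>0 a\<^sub>2, folded b_def]
      twice_differentiable_shifted_powr[of t\<^sub>0 n, folded \<phi>_def]
    by (simp only: greaterThan_iff) blast
  moreover have "\<forall>t > - t\<^sub>0. \<Lambda> (\<phi> t) = \<Lambda>\<^sub>0 * (t + t\<^sub>0) powr (- 2)"
    using Lambda_phi by (simp add: powr_minus power_divide inverse_eq_divide)
  ultimately show ?thesis ..
qed

end
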